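(* Let $\mathcal{I}=(N,A,V)$ be an instance of Fair Division with Externalities with binary valuations, i.e. $V_i(j,a)\in\{0,1\}$ for all $i,j\in N$ and $a\in A$, and let $\pi$ be an allocation of the items in $A$ to the agents in $N$. Then $\pi$ is EFX if and only if $\pi$ is EF1.
   Context: An instance $(N,A,V)$ of Fair Division with Externalities consists of a set of agents $N=\{1,\dots,n\}$, a nonempty set of indivisible items $A=\{a_1,\dots,a_m\}$, and for all agents $i,j\in N$ and every item $a\in A$ a number $V_i(j,a)$: the value agent $i$ gets if item $a$ is allocated to agent $j$ (here $j=i$ is allowed). An allocation of a set of items is a partition $\pi=(\pi_1,\dots,\pi_n)$ of that set into $n$ possibly empty bundles, $\pi_i$ being given to agent $i$; $\pi(a)$ denotes the agent receiving $a$. The value of $\pi$ for agent $i$ is $V_i(\pi)=\sum_a V_i(\pi(a),a)$, the sum ranging over the items allocated by $\pi$. $\pi^{i\leftrightarrow j}$ denotes the allocation obtained from $\pi$ by swapping the bundles of agents $i$ and $j$ and leaving the other bundles unchanged. An allocation $\pi$ of $A$ is: - envy-free up to one item (EF1) if for every pair of agents $i,j\in N$ there is an item $a\in A$ such that the allocation $\lambda$ (of $A\setminus\{a\}$) with $\lambda_\ell=\pi_\ell\setminus\{a\}$ for all $\ell\in N$ satisfies $V_i(\lambda)\ge V_i(\lambda^{i\leftrightarrow j})$; - envy-free up to any item (EFX) if for every pair of agents $i,j\in N$ with $V_i(\pi)<V_i(\pi^{i\leftrightarrow j})$ the following holds: for any item $a\in A$ and the allocation $\lambda$ with $\lambda_\ell=\pi_\ell\setminus\{a\}$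 for all $\ell\in N$, if $V_i(\lambda)-V_i(\lambda^{i\leftrightarrow j})>V_i(\pi)-V_i(\pi^{i\leftrightarrow j})$, then $V_i(\lambda)\ge V_i(\lambda^{i\leftrightarrow j})$. *)

theory Defs
  imports Complex_Main "HOL-Library.Disjoint_Sets"
begin

text \<open>
  The agents are the numbers \<open>1, \<dots>, n\<close>. An allocation maps every agent to its bundle;
  its values outside \<open>{1..n}\<close> are irrelevant. \<open>V i j a\<close> is the value agent \<open>i\<close> gets if
  item \<open>a\<close> is allocated to agent \<open>j\<close>.
\<close>

definition is_allocation :: "nat \<Rightarrow> 'a set \<Rightarrow> (nat \<Rightarrow> 'a set) \<Rightarrow> bool" where
  "is_allocation n B \<pi> \<longleftrightarrow> disjoint_family_on \<pi> {1..n} \<and> (\<Union>l\<in>{1..n}. \<pi> l) = B"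

text \<open>Only meaningful for items that are allocated by \<open>\<pi>\<close>, and then unique by disjointness.\<close>

definition receiver :: "nat \<Rightarrow> (nat \<Rightarrow> 'a set) \<Rightarrow> 'a \<Rightarrow> nat" where
  "receiver n \<pi> a = (THE l. l \<in> {1..n} \<and> a \<in> \<pi> l)"

definition alloc_value ::
    "nat \<Rightarrow> (nat \<Rightarrow> nat \<Rightarrow> 'a \<Rightarrow> real) \<Rightarrow> nat \<Rightarrow> (nat \<Rightarrow> 'a set) \<Rightarrow> real" where
  "alloc_value n V i \<pi> = (\<Sum>a\<in>(\<Union>l\<in>{1..n}. \<pi> l). V i (receiver n \<pi> a) a)"

definition swap_bundles :: "nat \<Rightarrow> nat \<Rightarrow> (nat \<Rightarrow> 'a set) \<Rightarrow> nat \<Rightarrow> 'a set" where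
  "swap_bundles i j \<pi> = \<pi>(i := \<pi> j, j := \<pi> i)"

definition remove_item :: "'a \<Rightarrow> (nat \<Rightarrow> 'a set) \<Rightarrow> nat \<Rightarrow> 'a set" where
  "remove_item a \<pi> = (\<lambda>l. \<pi> l - {a})"

definition EF1 ::
    "nat \<Rightarrow> 'a set \<Rightarrow> (nat \<Rightarrow> nat \<Rightarrow> 'a \<Rightarrow> real) \<Rightarrow> (nat \<Rightarrow> 'a set) \<Rightarrow> bool" where
  "EF1 n A V \<pi> \<longleftrightarrow>
     (\<forall>i\<in>{1..n}. \<forall>j\<in>{1..n}. \<exists>a\<in>A.
        let \<mu> = remove_item a \<pi>
        in alloc_value n V i \<mu> \<ge> alloc_value n V i (swap_bundles i j \<mu>))"

definition EFX ::
    "nat \<Rightarrow> 'a set \<Rightarrow> (nat \<Rightarrow> nat \<Rightarrow> 'a \<Rightarrow> real) \<Rightarrow> (nat \<Rightarrow> 'a set) \<Rightarrow> bool" where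
  "EFX n A V \<pi> \<longleftrightarrow>
     (\<forall>i\<in>{1..n}. \<forall>j\<in>{1..n}.
        alloc_value n V i \<pi> < alloc_value n V i (swap_bundles i j \<pi>) \<longrightarrow>
        (\<forall>a\<in>A.
           let \<mu> = remove_item a \<pi>
           in alloc_value n V i \<mu> - alloc_value n V i (swap_bundles i j \<mu>)
                > alloc_value n V i \<pi> - alloc_value n V i (swap_bundles i j \<pi>) \<longrightarrow>
              alloc_value n V i \<mu> \<ge> alloc_value n V i (swap_bundles i j \<mu>)))"

end

theory Submission
  imports Defs "HOL-Combinatorics.Transposition"
begin

text \<open>
  Fix agents \<open>i\<close>, \<open>j\<close> and let \<open>c a\<close> be the contribution of the item \<open>a\<close> to the difference
  \<open>d = V\<^sub>i(\<pi>) - V\<^sub>i(\<pi>\<^sup>i\<^sup>\<leftrightarrow>\<^sup>j)\<close>; removing \<open>a\<close> changes \<open>d\<close> to \<open>d - c a\<close>. For binary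
  valuations \<open>c a \<in> {-1, 0, 1}\<close>, so \<open>d\<close> is an integer, and if \<open>d < 0\<close> then some item has
  \<open>c a = -1\<close>. Hence both conditions say precisely that \<open>d \<ge> -1\<close>.
\<close>

lemma receiver_eq:
  assumes "is_allocation n B \<pi>" "l \<in> {1..n}" "b \<in> \<pi> l"
  shows "receiver n \<pi> b = l"
  unfolding receiver_def
proof (rule the_equality)
  show "k = l" if "k \<in> {1..n} \<and> b \<in> \<pi> k" for k
    using assms that unfolding is_allocation_def disjoint_family_on_def by blast
qed (use assms in simp)

lemma is_allocation_obtain_receiver:
  assumes "is_allocation n B \<pi>" "b \<in> B"
  obtains l where "l \<in> {1..n}" "b \<in> \<pi> l" "receiver n \<pi> b = l"
  using assms receiver_eq[OF assms(1)] unfolding is_allocation_def by blast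

text \<open>Turns the swap into reindexing by an involution, which permutes \<open>{1..n}\<close>
  when \<open>i\<close> and \<open>j\<close> are agents; \<open>i = j\<close> gives the
  identity.\<close>

lemma swap_bundles_eq_transpose: "swap_bundles i j \<pi> = \<pi> \<circ> transpose i j"
  by (auto simp: swap_bundles_def transpose_def fun_eq_iff)

lemma transpose_mem_iff:
  assumes "i \<in> S" "j \<in> S"
  shows "transpose i j l \<in> S \<longleftrightarrow> l \<in> S"
  using assms by (auto simp: transpose_def)

lemma is_allocation_swap_bundles:
  assumes "is_allocation n B \<pi>" "i \<in> {1..n}" "j \<in> {1..n}"
  shows "is_allocation n B (swap_bundles i j \<pi>)"
proof -
  have "transpose i j ` {1..n} = {1..n}"
    using assms(2,3) by simp
  then have "(\<Union>l\<in>{1..n}. (\<pi> \<circ> transpose i j) l) = (\<Union>l\<in>{1..n}. \<pi> l)"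
    by (metis image_comp)
  moreover have "disjoint_family_on (\<pi> \<circ> transpose i j) {1..n}"
    using assms transpose_mem_iff[OF assms(2,3)]
    unfolding is_allocation_def disjoint_family_on_def comp_def
    by (metis transpose_involutory)
  ultimately show ?thesis
    using assms(1) by (simp add: is_allocation_def swap_bundles_eq_transpose)
qed

text \<open>Since the transposition is its own inverse, the bundle of \<open>l\<close> in
  \<open>\<pi>\<close> is the bundle of \<open>transpose i j l\<close> after the swap.\<close>

lemma receiver_swap_bundles:
  assumes "is_allocation n B \<pi>" "i \<in> {1..n}" "j \<in> {1..n}" "b \<in> B"
  shows "receiver n (swap_bundles i j \<pi>) b = transpose i j (receiver n \<pi> b)"
proof -
  obtain l where l: "l \<in> {1..n}" "b \<in> \<pi> l" "receiver n \<pi> b = l"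
    using is_allocation_obtain_receiver assms(1,4) .
  show ?thesis
    using receiver_eq[OF is_allocation_swap_bundles[OF assms(1-3)], of "transpose i j l" b]
      l transpose_mem_iff[OF assms(2,3)]
    by (simp add: swap_bundles_eq_transpose)
qed

lemma is_allocation_remove_item:
  assumes "is_allocation n B \<pi>"
  shows "is_allocation n (B - {a}) (remove_item a \<pi>)"
  using assms unfolding is_allocation_def disjoint_family_on_def remove_item_def by blast

lemma receiver_remove_item:
  assumes "b \<noteq> a"
  shows "receiver n (remove_item a \<pi>) b = receiver n \<pi> b"
  using assms by (simp add: receiver_def remove_item_def)

text \<open>The contribution \<open>c a\<close> of the item \<open>a\<close>. It vanishes for items
  held by agents other than \<open>i\<close> and \<open>j\<close>; being defined through the
  receiver, it does not change when another item is removed.\<close>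

definition item_gain ::
    "nat \<Rightarrow> (nat \<Rightarrow> nat \<Rightarrow> 'a \<Rightarrow> real) \<Rightarrow> nat \<Rightarrow> nat \<Rightarrow> (nat \<Rightarrow> 'a set) \<Rightarrow> 'a \<Rightarrow> real" where
  "item_gain n V i j \<pi> a =
     V i (receiver n \<pi> a) a - V i (transpose i j (receiver n \<pi> a)) a"

lemma alloc_value_diff_swap_bundles:
  assumes "is_allocation n B \<pi>" "i \<in> {1..n}" "j \<in> {1..n}"
  shows "alloc_value n V i \<pi> - alloc_value n V i (swap_bundles i j \<pi>) =
           (\<Sum>a\<in>B. item_gain n V i j \<pi> a)"
proof -
  have "(\<Union>l\<in>{1..n}. \<pi> l) = B" "(\<Union>l\<in>{1..n}. swap_bundles i j \<pi> l) = B"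
    using assms(1) is_allocation_swap_bundles[OF assms] by (simp_all add: is_allocation_def)
  then show ?thesis
    unfolding alloc_value_def item_gain_def
    by (simp add: receiver_swap_bundles[OF assms] sum_subtractf)
qed

text \<open>Other items keep their receivers when \<open>a\<close> is removed, so the sum just loses
  the term of \<open>a\<close>.\<close>

lemma alloc_value_diff_remove_item:
  assumes "is_allocation n B \<pi>" "i \<in> {1..n}" "j \<in> {1..n}" "finite B" "a \<in> B"
  shows "alloc_value n V i (remove_item a \<pi>)
           - alloc_value n V i (swap_bundles i j (remove_item a \<pi>)) =
         (\<Sum>b\<in>B. item_gain n V i j \<pi> b) - item_gain n V i j \<pi> a"
proof -
  have "(\<Sum>b\<in>B - {a}. item_gain n V i j (remove_item a \<pi>) b) =
        (\<Sum>b\<in>B - {a}. item_gain n V i j \<pi> b)"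
    by (rule sum.cong) (simp_all add: item_gain_def receiver_remove_item)
  then show ?thesis
    using alloc_value_diff_swap_bundles[OF is_allocation_remove_item[OF assms(1)] assms(2,3)]
      assms(4,5) by (simp add: sum_diff1)
qed

text \<open>Values are known to be binary only for agents in \<open>{1..n}\<close>; the receiver
  lies there, and the transposition keeps it there.\<close>

lemma item_gain_binary:
  assumes "is_allocation n B \<pi>" "i \<in> {1..n}" "j \<in> {1..n}" "a \<in> B"
    and "\<forall>l\<in>{1..n}. V i l a \<in> {0, 1}"
  shows "item_gain n V i j \<pi> a \<in> {-1, 0, 1}"
proof -
  obtain l where "l \<in> {1..n}" "receiver n \<pi> a = l"
    using is_allocation_obtain_receiver assms(1,4) by metis
  then have "V i (receiver n \<pi> a) a \<in> {0, 1}"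
    "V i (transpose i j (receiver n \<pi> a)) a \<in> {0, 1}"
    using assms(5) transpose_mem_iff[OF assms(2,3)] by blast+
  then show ?thesis
    unfolding item_gain_def by auto
qed

text \<open>With \<open>c\<close> the gain per item, \<open>c a < 0\<close> says that dropping
  \<open>a\<close> strictly raises the difference, and \<open>c a \<le> sum c A\<close> that the
  difference after dropping \<open>a\<close> is nonnegative.\<close>

lemma drop_any_iff_drop_one:
  fixes c :: "'a \<Rightarrow> real"
  assumes "finite A" "A \<noteq> {}" and c: "\<forall>a\<in>A. c a \<in> {-1, 0, 1}"
  shows "(sum c A < 0 \<longrightarrow> (\<forall>a\<in>A. c a < 0 \<longrightarrow> c a \<le> sum c A)) \<longleftrightarrow> (\<exists>a\<in>A. c a \<le> sum c A)"
    (is "?any \<longleftrightarrow> ?one")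
proof
  assume ?any
  show ?one
  proof (cases "sum c A < 0")
    case True
    then obtain a where "a \<in> A" "c a < 0"
      using sum_nonneg[of A c] by (meson not_le)
    then show ?thesis
      using \<open>?any\<close> True by blast
  next
    case False
    show ?thesis
    proof (rule ccontr)
      assume "\<not> ?one"
      \<comment> \<open>As \<open>sum c A \<ge> 0\<close>, failure of \<open>?one\<close> makes
        every \<open>c a\<close> positive, hence \<open>1\<close>. The sum is then
        \<open>card A \<ge> 1\<close>, because \<open>A\<close> is nonempty, so any item satisfies
        \<open>?one\<close> after all.\<close>
      then have one: "c a = 1" if "a \<in> A" for a
        using that False c by fastforce
      then have "sum c A = real (card A)"
        by simp
      moreover have "card A \<ge> 1"
        using assms(1,2) by (simp add: card_gt_0_iff Suc_le_eq)
      ultimately show False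
        using \<open>\<not> ?one\<close> one \<open>A \<noteq> {}\<close> by auto
    qed
  qed
next
  assume ?one
  then have ge: "sum c A \<ge> -1"
    using c by force
  show ?any
  proof (intro impI ballI)
    fix a assume "a \<in> A" "c a < 0"
    \<comment> \<open>A negative \<open>c a\<close> must be \<open>-1\<close>, which is the bound in
      \<open>ge\<close>.\<close>
    then show "c a \<le> sum c A"
      using c ge by auto
  qed
qed

theorem proposition4p2:
  fixes n :: nat
    and A :: "'a set"
    and V :: "nat \<Rightarrow> nat \<Rightarrow> 'a \<Rightarrow> real"
    and \<pi> :: "nat \<Rightarrow> 'a set"
  assumes "finite A" and "A \<noteq> {}"
    and "\<forall>i\<in>{1..n}. \<forall>j\<in>{1..n}. \<forall>a\<in>A. V i j a \<in> {0, 1}"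
    and "is_allocation n A \<pi>"
  shows "EFX n A V \<pi> \<longleftrightarrow> EF1 n A V \<pi>"
proof -
  have "(alloc_value n V i \<pi> < alloc_value n V i (swap_bundles i j \<pi>) \<longrightarrow>
         (\<forall>a\<in>A.
           let \<mu> = remove_item a \<pi>
           in alloc_value n V i \<mu> - alloc_value n V i (swap_bundles i j \<mu>)
                > alloc_value n V i \<pi> - alloc_value n V i (swap_bundles i j \<pi>) \<longrightarrow>
              alloc_value n V i \<mu> \<ge> alloc_value n V i (swap_bundles i j \<mu>))) \<longleftrightarrow>
        (\<exists>a\<in>A. let \<mu> = remove_item a \<pi>
           in alloc_value n V i \<mu> \<ge> alloc_value n V i (swap_bundles i j \<mu>))"
    (is "?efx \<longleftrightarrow> ?ef1")
    if ij: "i \<in> {1..n}" "j \<in> {1..n}" for i j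
  proof -
    let ?c = "item_gain n V i j \<pi>"
    \<comment> \<open>Both \<open>d\<close> and \<open>r\<close> isolate the unswapped value, so
      rewriting with them cancels the swapped value from every comparison and leaves conditions on
      \<open>sum ?c A\<close> and \<open>?c a\<close> alone.\<close>
    have d: "alloc_value n V i \<pi> = alloc_value n V i (swap_bundles i j \<pi>) + sum ?c A"
      using alloc_value_diff_swap_bundles[OF assms(4) ij, of V] by simp
    have r: "alloc_value n V i (remove_item a \<pi>) =
        alloc_value n V i (swap_bundles i j (remove_item a \<pi>)) + (sum ?c A - ?c a)"
      if "a \<in> A" for a
      using alloc_value_diff_remove_item[OF assms(4) ij assms(1) that, of V] by simp
    have "?efx \<longleftrightarrow> (sum ?c A < 0 \<longrightarrow> (\<forall>a\<in>A. ?c a < 0 \<longrightarrow> ?c a \<le> sum ?c A))"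
      by (simp add: Let_def d r)
    also have "\<dots> \<longleftrightarrow> (\<exists>a\<in>A. ?c a \<le> sum ?c A)"
      by (intro drop_any_iff_drop_one ballI item_gain_binary[OF assms(4) ij])
        (use assms ij in blast)+
    also have "\<dots> \<longleftrightarrow> ?ef1"
      by (simp add: Let_def r)
    finally show ?thesis .
  qed
  then show ?thesis
    unfolding EFX_def EF1_def by simp
qed

end
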